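(* Let $X$ be a Hausdorff topological space and $Y$ a Hausdorff locally convex linear topological space. Let $F$ be a set-valued map from $X$ to $Y$ (identified with its graph, a subset of $X\times Y$). Then the following are equivalent: (1) $F\in MU(X,Y)\cap MC(X,Y)$, i.e. $F$ is both a minimal usco map and a minimal cusco map; (2) there exists a *-quasicontinuous and subcontinuous function $f:X\to Y$ such that $\overline{f}=F$; (3) every selection $f$ of $F$ is *-quasicontinuous, subcontinuous and satisfies $\overline{f}=F$.
   Context: A set-valued map $F$ from $X$ to $Y$ assigns to each $x\in X$ a subset $F(x)\subset Y$; it is identified with its graph $\{(x,y)\in X\times Y: y\in F(x)\}$, and conversely every subset $F\subset X\times Y$ is identified with the set-valued map $F(x)=\{y\in Y: (x,y)\in F\}$. A single-valued function $f:X\to Y$ is also identified with its graph; $\overline{f}$ denotes the closure of the graph of $f$ in $X\times Y$, and $\overline{f}(x)=\{y\in Y:(x,y)\in\overline{f}\}$. One says that $F$ contains $G$, written $G\subset F$, if $G(x)\subset F(x)$ for all $x\in X$. $F$ is upper semicontinuous if for every $x\in X$ and every open $V\supset F(x)$ there is an open neighborhood $U$ of $x$ with $F(u)\subset V$ for all $u\in U$. $F$ is usco if it is upper semicontinuous and all its values are nonempty and compact; $F$ is cusco if it is usco and all its values are convex. $F$ is minimal usco (minimal cusco) if it is usco (cusco) and does not properly contain any other usco (cusco) map from $X$ to $Y$. $MU(X,Y)$ and $MC(X,Y)$ denote the sets of all minimal usco and all minimal cusco maps from $X$ to $Y$, respectively. A selection of $F$ is a function $f:X\to Y$ with $f(x)\in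 F(x)$ for every $x\in X$. A function $f:X\to Y$ is subcontinuous if for every $x\in X$ and every net $(x_i)$ in $X$ converging to $x$, the net $(f(x_i))$ has a subnet converging in $Y$. $\overline{co}\,B$ denotes the closed convex hull of $B\subset Y$. A function $f:X\to Y$ is *-quasicontinuous if for every $x\in X$, every $y\in\overline{co}\,(\overline{f}(x))$, every open neighborhood $V$ of $y$ in $Y$ and every open neighborhood $U$ of $x$ in $X$, there is a nonempty open set $W\subset U$ such that $f(W)\subset V$.
   Formalization: Condition (3) additionally requires that F has at least one selection (equivalently, all values F(x) are nonempty); otherwise (3) holds vacuously, e.g. for F empty and X nonempty, while (1) and (2) fail. *)

theory Defs
  imports "HOL-Analysis.Analysis"
begin

section \<open>Locally convex spaces\<close>

text \<open>The Hausdorff axiom is not included; it is added through the sort \<^class>\<open>t2_space\<close>.\<close>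

class topological_real_vector = real_vector + topological_ab_group_add +
  assumes tendsto_scaleR_nhds:
    "((\<lambda>p. fst p *\<^sub>R snd p) \<longlongrightarrow> a *\<^sub>R x) (nhds a \<times>\<^sub>F nhds x)"

text \<open>The constant \<^const>\<open>convex\<close> is not available inside a class specification, so its definition
  is unfolded in the axiom; \<open>locally_convex\<close> below is the folded form.\<close>

class locally_convex_space = topological_real_vector +
  assumes locally_convex_unfolded:
    "open U \<Longrightarrow> 0 \<in> U \<Longrightarrow>
       \<exists>V. open V \<and>
           (\<forall>x\<in>V. \<forall>y\<in>V. \<forall>u\<ge>0. \<forall>v\<ge>0. u + v = 1 \<longrightarrow> u *\<^sub>R x + v *\<^sub>R y \<in> V) \<and>
           0 \<in> V \<and> V \<subseteq> U"

lemma locally_convex: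
  fixes U :: "'a::locally_convex_space set"
  assumes "open U" "0 \<in> U"
  shows "\<exists>V. open V \<and> convex V \<and> 0 \<in> V \<and> V \<subseteq> U"
  using locally_convex_unfolded[OF assms] unfolding convex_def .

section \<open>Usco and cusco maps\<close>

text \<open>A set-valued map is identified with its graph: \<open>F :: ('a \<times> 'b) set\<close> has the
  value \<open>F `` {x}\<close> at \<open>x\<close>, and containment of maps is inclusion of graphs.\<close>

definition upper_semicontinuous ::
    "('a::topological_space \<times> 'b::topological_space) set \<Rightarrow> bool" where
  "upper_semicontinuous F \<longleftrightarrow>
     (\<forall>x V. open V \<and> F `` {x} \<subseteq> V \<longrightarrow>
        (\<exists>U. open U \<and> x \<in> U \<and> (\<forall>u\<in>U. F `` {u} \<subseteq> V)))"

definition usco :: "('a::topological_space \<times> 'b::topological_space) set \<Rightarrow> bool" where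
  "usco F \<longleftrightarrow>
     upper_semicontinuous F \<and> (\<forall>x. F `` {x} \<noteq> {} \<and> compact (F `` {x}))"

definition cusco ::
    "('a::topological_space \<times> 'b::{real_vector,topological_space}) set \<Rightarrow> bool" where
  "cusco F \<longleftrightarrow> usco F \<and> (\<forall>x. convex (F `` {x}))"

definition MU :: "('a::topological_space \<times> 'b::topological_space) set set" where
  "MU = {F. usco F \<and> \<not> (\<exists>G. usco G \<and> G \<subset> F)}"

definition MC ::
    "('a::topological_space \<times> 'b::{real_vector,topological_space}) set set" where
  "MC = {F. cusco F \<and> \<not> (\<exists>G. cusco G \<and> G \<subset> F)}"

section \<open>Single-valued functions\<close>

text \<open>A map with an empty value has no selections at all, so ``every selection of \<open>F\<close> is \<dots>''
  is vacuous for it unless the existence of a selection is also required.\<close>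

definition selection :: "('a \<times> 'b) set \<Rightarrow> ('a \<Rightarrow> 'b) \<Rightarrow> bool" where
  "selection F f \<longleftrightarrow> (\<forall>x. f x \<in> F `` {x})"

definition graph_closure ::
    "('a::topological_space \<Rightarrow> 'b::topological_space) \<Rightarrow> ('a \<times> 'b) set" where
  "graph_closure f = closure {(x, f x) | x. True}"

definition star_quasicontinuous ::
    "('a::topological_space \<Rightarrow> 'b::{real_vector,topological_space}) \<Rightarrow> bool" where
  "star_quasicontinuous f \<longleftrightarrow>
     (\<forall>x. \<forall>y \<in> closure (convex hull (graph_closure f `` {x})).
        \<forall>V U. open V \<and> y \<in> V \<and> open U \<and> x \<in> U \<longrightarrow>
          (\<exists>W. open W \<and> W \<noteq> {} \<and> W \<subseteq> U \<and> f ` W \<subseteq> V))"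

section \<open>Nets and subcontinuity\<close>

definition directed_set :: "'i set \<Rightarrow> ('i \<Rightarrow> 'i \<Rightarrow> bool) \<Rightarrow> bool" where
  "directed_set D le \<longleftrightarrow>
     D \<noteq> {} \<and>
     (\<forall>a\<in>D. le a a) \<and>
     (\<forall>a\<in>D. \<forall>b\<in>D. \<forall>c\<in>D. le a b \<and> le b c \<longrightarrow> le a c) \<and>
     (\<forall>a\<in>D. \<forall>b\<in>D. \<exists>c\<in>D. le a c \<and> le b c)"

definition net_tendsto ::
    "'i set \<Rightarrow> ('i \<Rightarrow> 'i \<Rightarrow> bool) \<Rightarrow> ('i \<Rightarrow> 'a::topological_space) \<Rightarrow> 'a \<Rightarrow> bool" where
  "net_tendsto D le s l \<longleftrightarrow>
     (\<forall>U. open U \<and> l \<in> U \<longrightarrow> (\<exists>d\<in>D. \<forall>e\<in>D. le d e \<longrightarrow> s e \<in> U))"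

text \<open>Subnets in the sense of Kelley: the subnet of \<open>s\<close> given by \<open>\<phi>\<close> is \<open>s \<circ> \<phi>\<close>.\<close>

definition subnet_map ::
    "'i set \<Rightarrow> ('i \<Rightarrow> 'i \<Rightarrow> bool) \<Rightarrow> 'j set \<Rightarrow> ('j \<Rightarrow> 'j \<Rightarrow> bool) \<Rightarrow> ('j \<Rightarrow> 'i) \<Rightarrow> bool" where
  "subnet_map D le E le' \<phi> \<longleftrightarrow>
     directed_set E le' \<and> \<phi> ` E \<subseteq> D \<and>
     (\<forall>d\<in>D. \<exists>e\<in>E. \<forall>e'\<in>E. le' e e' \<longrightarrow> le d (\<phi> e'))"

text \<open>A formula cannot quantify over the types in which the index sets live. The definition
  therefore fixes two index types. They are large enough: by \<open>subcontinuous_net\<close> and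
  \<open>subcontinuous_netI\<close> below, nets and subnets indexed in arbitrary types give the same notion.\<close>

definition subcontinuous ::
    "('a::topological_space \<Rightarrow> 'b::topological_space) \<Rightarrow> bool" where
  "subcontinuous f \<longleftrightarrow>
     (\<forall>x. \<forall>(D :: ('a \<times> 'a set) set) le s.
        directed_set D le \<and> net_tendsto D le s x \<longrightarrow>
          (\<exists>(E :: (('a \<times> 'a set) \<times> 'b set) set) le' \<phi> y.
             subnet_map D le E le' \<phi> \<and> net_tendsto E le' (f \<circ> s \<circ> \<phi>) y))"

lemma convergent_subnet_imp_cluster_point:
  assumes sub: "subnet_map D le E le' \<phi>" and lim: "net_tendsto E le' (g \<circ> \<phi>) y"
    and V: "open V" "y \<in> V" and d: "d \<in> D"
  shows "\<exists>e\<in>D. le d e \<and> g e \<in> V"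
proof -
  have dir: "directed_set E le'" and image: "\<phi> ` E \<subseteq> D"
    and cofinal: "\<forall>d\<in>D. \<exists>e\<in>E. \<forall>e'\<in>E. le' e e' \<longrightarrow> le d (\<phi> e')"
    using sub unfolding subnet_map_def by simp_all
  have up: "\<forall>a\<in>E. \<forall>b\<in>E. \<exists>c\<in>E. le' a c \<and> le' b c"
    using dir unfolding directed_set_def by (elim conjE)
  obtain e1 where e1: "e1 \<in> E" "\<And>e. e \<in> E \<Longrightarrow> le' e1 e \<Longrightarrow> le d (\<phi> e)"
    using bspec[OF cofinal d] by blast
  have "\<exists>e\<in>E. \<forall>e'\<in>E. le' e e' \<longrightarrow> g (\<phi> e') \<in> V"
    using lim V by (simp add: net_tendsto_def)
  then obtain e2 where e2: "e2 \<in> E" "\<And>e. e \<in> E \<Longrightarrow> le' e2 e \<Longrightarrow> g (\<phi> e) \<in> V"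
    by blast
  obtain e3 where e3: "e3 \<in> E" "le' e1 e3" "le' e2 e3"
    using bspec[OF bspec[OF up e1(1)] e2(1)] by blast
  show ?thesis
    using e1(2)[OF e3(1,2)] e2(2)[OF e3(1,3)] image e3(1) by blast
qed

lemma cluster_point_imp_convergent_subnet:
  fixes D :: "'i set" and g :: "'i \<Rightarrow> 'b::topological_space"
  assumes dir: "directed_set D le"
    and cl: "\<And>V d. open V \<Longrightarrow> y \<in> V \<Longrightarrow> d \<in> D \<Longrightarrow> \<exists>e\<in>D. le d e \<and> g e \<in> V"
  shows "\<exists>(E :: ('i \<times> 'b set) set) le' \<phi>. subnet_map D le E le' \<phi> \<and> net_tendsto E le' (g \<circ> \<phi>) y"
proof -
  define E where "E = {(d, V). d \<in> D \<and> open V \<and> y \<in> V \<and> g d \<in> V}"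
  define le' where "le' = (\<lambda>(d, V :: 'b set) (e, W). le d e \<and> W \<subseteq> V)"
  have refl: "\<And>a. a \<in> D \<Longrightarrow> le a a"
    and trans: "\<And>a b c. \<lbrakk>a \<in> D; b \<in> D; c \<in> D; le a b; le b c\<rbrakk> \<Longrightarrow> le a c"
    and up: "\<And>a b. a \<in> D \<Longrightarrow> b \<in> D \<Longrightarrow> \<exists>c\<in>D. le a c \<and> le b c"
    and ne: "D \<noteq> {}"
    using dir unfolding directed_set_def by blast+
  have above: "\<exists>c. (c, V \<inter> W) \<in> E \<and> le a c \<and> le b c"
    if a: "a \<in> D" and b: "b \<in> D" and VW: "open V" "y \<in> V" "open W" "y \<in> W" for a b V W
  proof -
    obtain c where c: "c \<in> D" "le a c" "le b c" using up a b by blast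
    obtain e where e: "e \<in> D" "le c e" "g e \<in> V \<inter> W"
      using cl[of "V \<inter> W" c] VW c by blast
    then have "le a e" "le b e" using trans a b c by blast+
    then show ?thesis using e VW unfolding E_def by blast
  qed
  have memE: "d \<in> D" "open V" "y \<in> V" "g d \<in> V" if "(d, V) \<in> E" for d V
    using that unfolding E_def by auto
  have "directed_set E le'"
    unfolding directed_set_def
  proof (intro conjI ballI impI)
    obtain d where "d \<in> D" using ne by blast
    then show "E \<noteq> {}" unfolding E_def by auto
    show "le' a a" if "a \<in> E" for a
      using that refl memE unfolding le'_def by auto
    show "le' a c" if "a \<in> E" "b \<in> E" "c \<in> E" "le' a b \<and> le' b c" for a b c
      using that unfolding E_def le'_def by (auto intro: trans)
    show "\<exists>c\<in>E. le' a c \<and> le' b c" if ab: "a \<in> E" "b \<in> E" for a b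
    proof -
      obtain d V e W where eq: "a = (d, V)" "b = (e, W)" by (metis surj_pair)
      obtain c where "(c, V \<inter> W) \<in> E" "le d c" "le e c"
        using above[of d e V W] memE ab eq by blast
      then show ?thesis unfolding eq le'_def by auto
    qed
  qed
  moreover have "fst ` E \<subseteq> D" unfolding E_def by auto
  moreover have "\<exists>e\<in>E. \<forall>e'\<in>E. le' e e' \<longrightarrow> le d (fst e')" if "d \<in> D" for d
    using that by (intro bexI[of _ "(d, UNIV)"]) (auto simp: E_def le'_def)
  ultimately have "subnet_map D le E le' fst" unfolding subnet_map_def by blast
  moreover have "net_tendsto E le' (g \<circ> fst) y"
    unfolding net_tendsto_def
  proof (intro allI impI)
    fix V assume V: "open V \<and> y \<in> V"
    obtain d where "d \<in> D" using ne by blast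
    then obtain c where "(c, V) \<in> E" using above[of d d V V] V by auto
    then show "\<exists>e\<in>E. \<forall>e'\<in>E. le' e e' \<longrightarrow> (g \<circ> fst) e' \<in> V"
      by (intro bexI[of _ "(c, V)"]) (auto simp: E_def le'_def)
  qed
  ultimately show ?thesis by blast
qed

lemma subcontinuous_net:
  fixes f :: "'a::topological_space \<Rightarrow> 'b::topological_space" and D :: "'i set"
  assumes f: "subcontinuous f" and dir: "directed_set D le" and lim: "net_tendsto D le s x"
  shows "\<exists>(E :: ('i \<times> 'b set) set) le' \<phi> y.
           subnet_map D le E le' \<phi> \<and> net_tendsto E le' (f \<circ> s \<circ> \<phi>) y"
proof -
  define T where "T d = s ` {e \<in> D. le d e}" for d
  define D' where "D' = {(a, S). a \<in> S \<and> (\<exists>d\<in>D. S = T d)}"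
  define le2 where "le2 = (\<lambda>(a :: 'a, S) (b :: 'a, S' :: 'a set). S' \<subseteq> S)"
  have refl: "\<And>a. a \<in> D \<Longrightarrow> le a a"
    and trans: "\<And>a b c. \<lbrakk>a \<in> D; b \<in> D; c \<in> D; le a b; le b c\<rbrakk> \<Longrightarrow> le a c"
    and up: "\<And>a b. a \<in> D \<Longrightarrow> b \<in> D \<Longrightarrow> \<exists>c\<in>D. le a c \<and> le b c"
    and ne: "D \<noteq> {}"
    using dir unfolding directed_set_def by blast+
  have inD': "(s d, T d) \<in> D'" if "d \<in> D" for d
    using that refl unfolding D'_def T_def by auto
  have Tmono: "T e \<subseteq> T d" if "d \<in> D" "e \<in> D" "le d e" for d e
    using that trans unfolding T_def by blast
  have dir': "directed_set D' le2"
    unfolding directed_set_def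
  proof (intro conjI ballI impI)
    show "D' \<noteq> {}" using ne inD' by blast
    show "le2 a a" for a by (auto simp: le2_def)
    show "le2 a c" if "le2 a b \<and> le2 b c" for a b c
      using that by (auto simp: le2_def)
    show "\<exists>c\<in>D'. le2 a c \<and> le2 b c" if ab: "a \<in> D'" "b \<in> D'" for a b
    proof -
      obtain d1 d2 where d: "d1 \<in> D" "d2 \<in> D" "snd a = T d1" "snd b = T d2"
        using ab unfolding D'_def by auto
      obtain c where c: "c \<in> D" "le d1 c" "le d2 c" using up d by blast
      have "T c \<subseteq> snd a" "T c \<subseteq> snd b" using Tmono c d by auto
      then show ?thesis using inD'[OF c(1)]
        by (intro bexI[of _ "(s c, T c)"]) (auto simp: le2_def split: prod.splits)
    qed
  qed
  have lim': "net_tendsto D' le2 fst x"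
    unfolding net_tendsto_def
  proof (intro allI impI)
    fix U assume "open U \<and> x \<in> U"
    then obtain d where d: "d \<in> D" "\<forall>e\<in>D. le d e \<longrightarrow> s e \<in> U"
      using lim unfolding net_tendsto_def by blast
    then have "T d \<subseteq> U" unfolding T_def by auto
    then show "\<exists>d\<in>D'. \<forall>e\<in>D'. le2 d e \<longrightarrow> fst e \<in> U"
      using inD'[OF d(1)] by (intro bexI[of _ "(s d, T d)"]) (auto simp: le2_def D'_def)
  qed
  obtain E :: "(('a \<times> 'a set) \<times> 'b set) set" and le' \<phi> y
    where sub: "subnet_map D' le2 E le' \<phi>" "net_tendsto E le' ((f \<circ> fst) \<circ> \<phi>) y"
    using f dir' lim' unfolding subcontinuous_def by blast
  have "\<exists>e\<in>D. le d e \<and> (f \<circ> s) e \<in> V" if V: "open V" "y \<in> V" and d: "d \<in> D" for V d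
  proof -
    obtain p where "p \<in> D'" "le2 (s d, T d) p" "f (fst p) \<in> V"
      using convergent_subnet_imp_cluster_point[OF sub V inD'[OF d]] by auto
    then have "fst p \<in> T d" "f (fst p) \<in> V" by (auto simp: D'_def le2_def)
    then show ?thesis unfolding T_def by auto
  qed
  then show ?thesis
    using cluster_point_imp_convergent_subnet[OF dir, of y "f \<circ> s"] by blast
qed

lemma subcontinuous_netI:
  fixes f :: "'a::topological_space \<Rightarrow> 'b::topological_space"
  assumes "\<And>x (D :: ('a \<times> 'a set) set) le s.
      directed_set D le \<Longrightarrow> net_tendsto D le s x \<Longrightarrow>
      \<exists>(E :: 'j set) le' \<phi> y. subnet_map D le E le' \<phi> \<and> net_tendsto E le' (f \<circ> s \<circ> \<phi>) y"
  shows "subcontinuous f"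
  unfolding subcontinuous_def
proof (intro allI impI)
  fix x and D :: "('a \<times> 'a set) set" and le and s :: "'a \<times> 'a set \<Rightarrow> 'a"
  assume *: "directed_set D le \<and> net_tendsto D le s x"
  then obtain E :: "'j set" and le' \<phi> y
    where sub: "subnet_map D le E le' \<phi>" "net_tendsto E le' (f \<circ> s \<circ> \<phi>) y"
    using assms by blast
  have "\<exists>e\<in>D. le d e \<and> (f \<circ> s) e \<in> V" if "open V" "y \<in> V" "d \<in> D" for V d
    using convergent_subnet_imp_cluster_point[OF sub that] .
  then show "\<exists>(E :: (('a \<times> 'a set) \<times> 'b set) set) le' \<phi> y.
      subnet_map D le E le' \<phi> \<and> net_tendsto E le' (f \<circ> s \<circ> \<phi>) y"
    using cluster_point_imp_convergent_subnet[of D le y "f \<circ> s"] * by blast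
qed

end

theory Submission
  imports Defs
begin

text \<open>Subcontinuity and regularity of the range make \<open>graph_closure f\<close> usco, and *-quasicontinuity
  says exactly that its values are closed and convex and that each of its points is approximated by
  values of \<open>f\<close> on whole open sets; the latter rules out a smaller usco map, hence a smaller cusco
  map. Conversely, a minimal usco map \<open>F\<close> maps some nonempty open \<open>W \<subseteq> U\<close> into \<open>V\<close> whenever the
  open box \<open>U \<times> V\<close> meets \<open>F\<close>, since otherwise \<open>F - U \<times> V\<close> would be a smaller usco map.\<close>

section \<open>Closures and regularity in topological groups\<close>

lemma mem_closure_iff_open_meets:
  "y \<in> closure S \<longleftrightarrow> (\<forall>V. open V \<and> y \<in> V \<longrightarrow> V \<inter> S \<noteq> {})"
proof
  assume "y \<in> closure S"
  then show "\<forall>V. open V \<and> y \<in> V \<longrightarrow> V \<inter> S \<noteq> {}"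
    using open_Int_closure_eq_empty by blast
next
  assume meets: "\<forall>V. open V \<and> y \<in> V \<longrightarrow> V \<inter> S \<noteq> {}"
  show "y \<in> closure S"
  proof (rule ccontr)
    assume "y \<notin> closure S"
    then show False
      using meets[rule_format, of "- closure S"] closure_subset[of S] by blast
  qed
qed

text \<open>Continuity of \<open>a + b - y\<close> at \<open>(y, y)\<close> gives neighbourhoods
  \<open>A\<close> and \<open>B\<close> of \<open>y\<close> whose combinations
  \<open>a + b - y\<close> stay in \<open>V\<close>; the closure of \<open>A\<close> then cannot
  leave \<open>V\<close>.\<close>

lemma topological_ab_group_add_regular:
  fixes y :: "'b::topological_ab_group_add"
  assumes V: "open V" "y \<in> V"
  obtains W where "open W" "y \<in> W" "closure W \<subseteq> V"
proof -
  define S where "S = (\<lambda>p :: 'b \<times> 'b. fst p + snd p - y) -` V"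
  have "open S"
    unfolding S_def by (intro open_vimage V continuous_intros)
  moreover have "(y, y) \<in> S"
    using V by (simp add: S_def)
  ultimately obtain A B where AB: "open A" "open B" "(y, y) \<in> A \<times> B" "A \<times> B \<subseteq> S"
    by (rule open_prod_elim)
  have "closure A \<subseteq> V"
  proof
    fix z assume z: "z \<in> closure A"
    \<comment> \<open>This preimage is \<open>y + z - B\<close>, a neighbourhood of \<open>z\<close>
      because \<open>y \<in> B\<close>. A point \<open>w\<close> of \<open>A\<close> in it gives
      \<open>z = w + (y + z - w) - y\<close>.\<close>
    have "open ((\<lambda>w. y + z - w) -` B)"
      by (intro open_vimage AB continuous_intros)
    moreover have "z \<in> (\<lambda>w. y + z - w) -` B"
      using AB by simp
    ultimately obtain w where "w \<in> A" "y + z - w \<in> B"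
      using z unfolding mem_closure_iff_open_meets by blast
    then have "(w, y + z - w) \<in> S" using AB by blast
    then show "z \<in> V" by (simp add: S_def)
  qed
  then show thesis using that AB by blast
qed

text \<open>Regularity is applied to the complement of \<open>K\<close>, which is open in a
  Hausdorff space. The conclusion has \<open>closure V\<close> because control of \<open>f\<close>
  on an open set bounds the values of \<open>graph_closure f\<close> there only up to
  closure.\<close>

lemma separate_point_compact:
  fixes y :: "'b::{topological_ab_group_add,t2_space}"
  assumes "compact K" "y \<notin> K"
  obtains V W where "open V" "open W" "y \<in> V" "K \<subseteq> W" "closure V \<inter> W = {}"
proof -
  obtain V where "open V" "y \<in> V" "closure V \<subseteq> - K"
    using topological_ab_group_add_regular[of "- K" y] assms compact_imp_closed by blast
  then show thesis using that[of V "- closure V"] by blast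
qed

section \<open>Closure of the graph of a function\<close>

lemma mem_graph_closure_iff:
  "(x, y) \<in> graph_closure f \<longleftrightarrow>
     (\<forall>U V. open U \<and> x \<in> U \<and> open V \<and> y \<in> V \<longrightarrow> (\<exists>u\<in>U. f u \<in> V))"
proof
  assume xy: "(x, y) \<in> graph_closure f"
  show "\<forall>U V. open U \<and> x \<in> U \<and> open V \<and> y \<in> V \<longrightarrow> (\<exists>u\<in>U. f u \<in> V)"
  proof (intro allI impI)
    fix U V assume "open U \<and> x \<in> U \<and> open V \<and> y \<in> V"
    then have "open (U \<times> V)" "(x, y) \<in> U \<times> V" by (auto simp: open_Times)
    then have "(U \<times> V) \<inter> {(x, f x) | x. True} \<noteq> {}"
      using xy unfolding graph_closure_def mem_closure_iff_open_meets by blast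
    then show "\<exists>u\<in>U. f u \<in> V" by auto
  qed
next
  assume R: "\<forall>U V. open U \<and> x \<in> U \<and> open V \<and> y \<in> V \<longrightarrow> (\<exists>u\<in>U. f u \<in> V)"
  show "(x, y) \<in> graph_closure f"
    unfolding graph_closure_def mem_closure_iff_open_meets
  proof (intro allI impI)
    fix S assume "open S \<and> (x, y) \<in> S"
    then obtain U V where "open U" "open V" "(x, y) \<in> U \<times> V" "U \<times> V \<subseteq> S"
      using open_prod_elim by metis
    then show "S \<inter> {(x, f x) | x. True} \<noteq> {}"
      using R[rule_format, of U V] by blast
  qed
qed

lemma graph_subset_graph_closure: "(x, f x) \<in> graph_closure f"
  by (auto simp: mem_graph_closure_iff)

lemma graph_closure_image_subset:
  assumes "open U" "u \<in> U"
  shows "graph_closure f `` {u} \<subseteq> closure (f ` U)"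
  using assms by (force simp: mem_graph_closure_iff mem_closure_iff_open_meets)

lemma graph_closure_subset:
  assumes "closed F" "selection F f"
  shows "graph_closure f \<subseteq> F"
  unfolding graph_closure_def
  using assms by (intro closure_minimal) (auto simp: selection_def)

section \<open>Subcontinuity and compactness\<close>

text \<open>Translates convergent subnets into cluster points of filters, so that the covering
  argument below can be run with filters.\<close>

lemma subcontinuous_filter:
  fixes f :: "'a::topological_space \<Rightarrow> 'b::topological_space"
  assumes f: "subcontinuous f" and G: "G \<noteq> bot" "G \<le> nhds x"
  obtains y where "\<And>V. open V \<Longrightarrow> y \<in> V \<Longrightarrow> \<exists>\<^sub>F a in G. f a \<in> V"
proof -
  \<comment> \<open>The usual net of a filter: the indices are members \<open>S\<close> of
    \<open>G\<close> with a chosen point, ordered by reverse inclusion, and the net is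
    \<open>fst\<close>.\<close>
  define D where "D = {(a, S). a \<in> S \<and> eventually (\<lambda>a. a \<in> S) G}"
  define le where "le = (\<lambda>(a :: 'a, S) (b :: 'a, T :: 'a set). T \<subseteq> S)"
  have ex: "\<exists>a. (a, S) \<in> D" if "eventually (\<lambda>a. a \<in> S) G" for S
    using that eventually_happens'[OF G(1) that] by (auto simp: D_def)
  have dir: "directed_set D le"
    unfolding directed_set_def
  proof (intro conjI ballI impI)
    show "D \<noteq> {}" using ex[of UNIV] by auto
    show "\<exists>c\<in>D. le a c \<and> le b c" if ab: "a \<in> D" "b \<in> D" for a b
    proof -
      have "eventually (\<lambda>x. x \<in> snd a \<inter> snd b) G"
        using ab by (auto simp: D_def intro: eventually_conj)
      then obtain c where "(c, snd a \<inter> snd b) \<in> D" using ex by blast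
      then show ?thesis by (rule bexI[rotated]) (auto simp: le_def split: prod.splits)
    qed
  qed (auto simp: le_def)
  have lim: "net_tendsto D le fst x"
    unfolding net_tendsto_def
  proof (intro allI impI)
    fix U assume "open U \<and> x \<in> U"
    then have "eventually (\<lambda>a. a \<in> U) G"
      using G(2) eventually_nhds_in_open unfolding le_filter_def by blast
    then obtain a where "(a, U) \<in> D" using ex by blast
    then show "\<exists>d\<in>D. \<forall>e\<in>D. le d e \<longrightarrow> fst e \<in> U"
      by (rule bexI[rotated]) (auto simp: le_def D_def)
  qed
  obtain E :: "(('a \<times> 'a set) \<times> 'b set) set" and le' \<phi> y
    where sub: "subnet_map D le E le' \<phi>" "net_tendsto E le' ((f \<circ> fst) \<circ> \<phi>) y"
    using subcontinuous_net[OF f dir lim] by blast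
  show thesis
  proof (rule that[of y])
    fix V assume V: "open V" "y \<in> V"
    show "\<exists>\<^sub>F a in G. f a \<in> V"
      unfolding frequently_def
    proof
      \<comment> \<open>The set where \<open>f\<close> avoids \<open>V\<close> would be a member of
        \<open>G\<close>, hence part of an index beyond which the net never enters
        \<open>V\<close>.\<close>
      assume "\<forall>\<^sub>F a in G. f a \<notin> V"
      then have "\<forall>\<^sub>F a in G. a \<in> {a. f a \<notin> V}" by simp
      then obtain a where "(a, {a. f a \<notin> V}) \<in> D" using ex by blast
      then obtain e where "e \<in> D" "le (a, {a. f a \<notin> V}) e" "(f \<circ> fst) e \<in> V"
        using convergent_subnet_imp_cluster_point[OF sub V] by blast
      then show False by (auto simp: D_def le_def)
    qed
  qed
qed

text \<open>If no finite subfamily worked, the complements of the finite unions would generate,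
  together with the neighbourhoods of \<open>x\<close>, a proper filter without cluster point.\<close>

lemma subcontinuous_finite_subcover:
  fixes f :: "'a::topological_space \<Rightarrow> 'b::topological_space"
  assumes f: "subcontinuous f"
    and C: "\<And>W. W \<in> C \<Longrightarrow> open W" "graph_closure f `` {x} \<subseteq> \<Union>C"
  shows "\<exists>U D. open U \<and> x \<in> U \<and> finite D \<and> D \<subseteq> C \<and> f ` U \<subseteq> \<Union>D"
proof (rule ccontr)
  assume none_ex: "\<not> ?thesis"
  then have none: "\<not> f ` U \<subseteq> \<Union>D" if "open U" "x \<in> U" "finite D" "D \<subseteq> C" for U D
    using none_ex that by blast
  define H where "H = (INF D\<in>{D. finite D \<and> D \<subseteq> C}. principal (- f -` \<Union>D))"
  define G where "G = inf (nhds x) H"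
  \<comment> \<open>The complements are directed, since two finite subfamilies have a finite union;
    a single \<open>D\<close> therefore decides each eventual property.\<close>
  have H: "eventually P H \<longleftrightarrow> (\<exists>D. finite D \<and> D \<subseteq> C \<and> (\<forall>a. f a \<notin> \<Union>D \<longrightarrow> P a))" for P
    unfolding H_def
  proof (subst eventually_INF_base)
    show "{D. finite D \<and> D \<subseteq> C} \<noteq> {}" by auto
    show "\<exists>D\<in>{D. finite D \<and> D \<subseteq> C}. principal (- f -` \<Union>D) \<le>
        inf (principal (- f -` \<Union>A)) (principal (- f -` \<Union>B))"
      if "A \<in> {D. finite D \<and> D \<subseteq> C}" "B \<in> {D. finite D \<and> D \<subseteq> C}" for A B
      using that by (intro bexI[of _ "A \<union> B"]) auto
  qed (auto simp: eventually_principal)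
  have "G \<noteq> bot"
  proof
    assume "G = bot"
    then have "eventually (\<lambda>_. False) (inf (nhds x) H)"
      by (simp add: G_def)
    then obtain P Q where PQ: "eventually P (nhds x)" "eventually Q H" "\<And>a. P a \<Longrightarrow> Q a \<Longrightarrow> False"
      unfolding eventually_inf by blast
    obtain U where U: "open U" "x \<in> U" "\<And>u. u \<in> U \<Longrightarrow> P u"
      using PQ(1) unfolding eventually_nhds by blast
    obtain D where D: "finite D" "D \<subseteq> C" "\<And>a. f a \<notin> \<Union>D \<Longrightarrow> Q a"
      using PQ(2) unfolding H by blast
    \<comment> \<open>On \<open>U\<close> the property \<open>P\<close> holds, so \<open>Q\<close>
      must fail there; this places \<open>f u\<close> in the union of \<open>D\<close> for every
      \<open>u \<in> U\<close>.\<close>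
    show False using none[OF U(1,2) D(1,2)] U(3) D(3) PQ(3) by blast
  qed
  then obtain y where y: "\<And>V. open V \<Longrightarrow> y \<in> V \<Longrightarrow> \<exists>\<^sub>F a in G. f a \<in> V"
    using subcontinuous_filter[OF f, of G x] by (auto simp: G_def)
  have "(x, y) \<in> graph_closure f"
    unfolding mem_graph_closure_iff
  proof (intro allI impI)
    fix U V assume UV: "open U \<and> x \<in> U \<and> open V \<and> y \<in> V"
    then have "\<forall>\<^sub>F a in G. a \<in> U"
      unfolding G_def by (intro filter_leD[OF inf_le1] eventually_nhds_in_open) auto
    moreover have "\<exists>\<^sub>F a in G. f a \<in> V" using y[of V] UV by simp
    ultimately have "\<exists>\<^sub>F a in G. a \<in> U \<and> f a \<in> V"
      by (rule frequently_eventually_conj[rotated])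
    then show "\<exists>u\<in>U. f u \<in> V" using frequently_ex by blast
  qed
  then obtain W where W: "W \<in> C" "y \<in> W" using C(2) by blast
  \<comment> \<open>The singleton \<open>{W}\<close> is one of the finite subfamilies, so
    \<open>f\<close> eventually avoids \<open>W\<close>, although \<open>y\<close> is a cluster
    point in \<open>W\<close>.\<close>
  have "\<forall>\<^sub>F a in H. f a \<notin> W"
    unfolding H using W by (intro exI[of _ "{W}"]) auto
  then have "\<forall>\<^sub>F a in G. f a \<notin> W"
    unfolding G_def by (rule filter_leD[OF inf_le2])
  then show False using y[OF C(1)[OF W(1)] W(2)] by (simp add: frequently_def)
qed

text \<open>The cover is first shrunk to open sets whose closures lie in members of
  \<open>C\<close>: bounding \<open>f\<close> on \<open>U\<close> by the shrunken sets bounds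
  \<open>graph_closure f\<close> over \<open>U\<close> by their closures. Taking
  \<open>u = x\<close> yields compact values, and a one-member cover yields upper
  semicontinuity.\<close>

lemma graph_closure_finite_subcover:
  fixes f :: "'a::topological_space \<Rightarrow> 'b::topological_ab_group_add"
  assumes f: "subcontinuous f"
    and C: "\<And>V. V \<in> C \<Longrightarrow> open V" "graph_closure f `` {x} \<subseteq> \<Union>C"
  obtains U D where "open U" "x \<in> U" "finite D" "D \<subseteq> C"
    "\<And>u. u \<in> U \<Longrightarrow> graph_closure f `` {u} \<subseteq> \<Union>D"
proof -
  define C' where "C' = {W. open W \<and> (\<exists>V\<in>C. closure W \<subseteq> V)}"
  have "graph_closure f `` {x} \<subseteq> \<Union>C'"
  proof
    fix y assume "y \<in> graph_closure f `` {x}"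
    then obtain V where V: "V \<in> C" "y \<in> V" using C(2) by blast
    obtain W where "open W" "y \<in> W" "closure W \<subseteq> V"
      using topological_ab_group_add_regular[OF C(1)[OF V(1)] V(2)] .
    then show "y \<in> \<Union>C'" using V unfolding C'_def by blast
  qed
  moreover have "open W" if "W \<in> C'" for W using that by (simp add: C'_def)
  ultimately obtain U D' where U: "open U" "x \<in> U" "finite D'" "D' \<subseteq> C'" "f ` U \<subseteq> \<Union>D'"
    using subcontinuous_finite_subcover[OF f, of C' x] by metis
  have "\<forall>W\<in>D'. \<exists>V\<in>C. closure W \<subseteq> V" using U(4) by (auto simp: C'_def)
  then obtain g where g: "\<And>W. W \<in> D' \<Longrightarrow> g W \<in> C \<and> closure W \<subseteq> g W" by metis
  have "closure (f ` U) \<subseteq> closure (\<Union>D')" using U(5) by (rule closure_mono)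
  also have "\<dots> = (\<Union>W\<in>D'. closure W)" using U(3) by (induction D') auto
  also have "\<dots> \<subseteq> \<Union>(g ` D')" using g by blast
  finally have "graph_closure f `` {u} \<subseteq> \<Union>(g ` D')" if "u \<in> U" for u
    using graph_closure_image_subset[OF U(1) that] by (meson subset_trans)
  then show thesis using that[of U "g ` D'"] U g by blast
qed

lemma usco_graph_closure:
  fixes f :: "'a::topological_space \<Rightarrow> 'b::topological_ab_group_add"
  assumes f: "subcontinuous f"
  shows "usco (graph_closure f)"
  unfolding usco_def upper_semicontinuous_def
proof (intro conjI allI impI)
  fix x
  show "graph_closure f `` {x} \<noteq> {}" using graph_subset_graph_closure by blast
  show "compact (graph_closure f `` {x})"
  proof (rule compactI)
    fix C assume "\<forall>V\<in>C. open V" "graph_closure f `` {x} \<subseteq> \<Union>C"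
    then obtain U D where "x \<in> U" "finite D" "D \<subseteq> C"
        "\<And>u. u \<in> U \<Longrightarrow> graph_closure f `` {u} \<subseteq> \<Union>D"
      using graph_closure_finite_subcover[OF f, of C x] by metis
    then show "\<exists>D\<subseteq>C. finite D \<and> graph_closure f `` {x} \<subseteq> \<Union>D" by blast
  qed
  fix V assume V: "open V \<and> graph_closure f `` {x} \<subseteq> V"
  \<comment> \<open>The subfamily \<open>D\<close> is empty or \<open>{V}\<close>; either way its
    union lies in \<open>V\<close>.\<close>
  obtain U D where UD: "open U" "x \<in> U" "D \<subseteq> {V}"
      "\<And>u. u \<in> U \<Longrightarrow> graph_closure f `` {u} \<subseteq> \<Union>D"
    by (rule graph_closure_finite_subcover[OF f, of "{V}" x]) (use V in auto)
  have "\<forall>u\<in>U. graph_closure f `` {u} \<subseteq> V" using UD(3,4) by blast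
  then show "\<exists>U. open U \<and> x \<in> U \<and> (\<forall>u\<in>U. graph_closure f `` {u} \<subseteq> V)"
    using UD(1,2) by blast
qed

section \<open>Usco maps and their selections\<close>

lemma usco_nhdE:
  assumes "usco F" "open V" "F `` {x} \<subseteq> V"
  obtains U where "open U" "x \<in> U" "\<And>u. u \<in> U \<Longrightarrow> F `` {u} \<subseteq> V"
proof -
  have "\<exists>U. open U \<and> x \<in> U \<and> (\<forall>u\<in>U. F `` {u} \<subseteq> V)"
    using assms by (simp add: usco_def upper_semicontinuous_def)
  then show thesis using that by metis
qed

text \<open>A point off the graph is separated from the compact value, and upper semicontinuity
  keeps nearby values on the other side. Closedness is what confines \<open>graph_closure f\<close>
  to \<open>F\<close> for every selection \<open>f\<close>.\<close>

lemma usco_closed: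
  fixes F :: "('a::topological_space \<times> 'b::{topological_ab_group_add,t2_space}) set"
  assumes F: "usco F"
  shows "closed F"
  unfolding closed_def
proof (subst open_subopen, intro ballI)
  fix p assume "p \<in> - F"
  then obtain x y where p: "p = (x, y)" "y \<notin> F `` {x}" by (cases p) auto
  have "compact (F `` {x})" using F by (simp add: usco_def)
  then obtain V W where VW: "open V" "open W" "y \<in> V" "F `` {x} \<subseteq> W" "closure V \<inter> W = {}"
    using p(2) by (rule separate_point_compact)
  obtain U where U: "open U" "x \<in> U" "\<And>u. u \<in> U \<Longrightarrow> F `` {u} \<subseteq> W"
    using usco_nhdE[OF F VW(2,4)] by blast
  have "U \<times> V \<subseteq> - F"
    using U(3) VW(5) closure_subset[of V] by blast
  then show "\<exists>T. open T \<and> p \<in> T \<and> T \<subseteq> - F"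
    using p(1) U(1,2) VW(1,3) by (intro exI[of _ "U \<times> V"]) (auto simp: open_Times)
qed

text \<open>Some point of the compact value at \<open>x\<close> must be a cluster point of
  \<open>f \<circ> s\<close>. Otherwise finitely many open sets that the net eventually avoids would
  cover this value, and by upper semicontinuity all values near \<open>x\<close>.\<close>

lemma usco_selection_subcontinuous:
  fixes f :: "'a::topological_space \<Rightarrow> 'b::topological_space"
  assumes F: "usco F" and f: "selection F f"
  shows "subcontinuous f"
  unfolding subcontinuous_def
proof (intro allI impI)
  fix x and D :: "('a \<times> 'a set) set" and le and s :: "'a \<times> 'a set \<Rightarrow> 'a"
  assume "directed_set D le \<and> net_tendsto D le s x"
  then have dir: "directed_set D le" and lim: "net_tendsto D le s x" by auto
  have ne: "D \<noteq> {}" and trans: "\<And>a b c. \<lbrakk>a \<in> D; b \<in> D; c \<in> D; le a b; le b c\<rbrakk> \<Longrightarrow> le a c"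
    and up: "\<And>a b. a \<in> D \<Longrightarrow> b \<in> D \<Longrightarrow> \<exists>c\<in>D. le a c \<and> le b c"
    using dir unfolding directed_set_def by blast+
  have "\<exists>y\<in>F `` {x}. \<forall>V d. open V \<longrightarrow> y \<in> V \<longrightarrow> d \<in> D \<longrightarrow> (\<exists>e\<in>D. le d e \<and> f (s e) \<in> V)"
  proof (rule ccontr)
    assume no: "\<not> ?thesis"
    define C where "C = {V. open V \<and> (\<exists>d\<in>D. \<forall>e\<in>D. le d e \<longrightarrow> f (s e) \<notin> V)}"
    have "F `` {x} \<subseteq> \<Union>C"
    proof
      fix y assume "y \<in> F `` {x}"
      then obtain V d where "open V" "y \<in> V" "d \<in> D" "\<forall>e\<in>D. le d e \<longrightarrow> f (s e) \<notin> V"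
        using no by metis
      then show "y \<in> \<Union>C" unfolding C_def by blast
    qed
    moreover have "compact (F `` {x})" using F by (simp add: usco_def)
    moreover have "\<forall>V\<in>C. open V" by (simp add: C_def)
    ultimately obtain C' where C': "C' \<subseteq> C" "finite C'" "F `` {x} \<subseteq> \<Union>C'"
      by (metis compactE)
    \<comment> \<open>Directedness merges the finitely many tails, one per member of
      \<open>C'\<close>, into one.\<close>
    have "\<exists>d\<in>D. \<forall>e\<in>D. le d e \<longrightarrow> f (s e) \<notin> \<Union>C'"
      using C'(2,1)
    proof (induction C')
      case empty
      then show ?case using ne by auto
    next
      case (insert V C')
      have "C' \<subseteq> C" using insert.prems by simp
      from insert.IH[OF this]
      obtain d1 where d1: "d1 \<in> D" "\<forall>e\<in>D. le d1 e \<longrightarrow> f (s e) \<notin> \<Union>C'" by (elim bexE)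
      have "V \<in> C" using insert.prems by simp
      then obtain d2 where d2: "d2 \<in> D" "\<forall>e\<in>D. le d2 e \<longrightarrow> f (s e) \<notin> V"
        unfolding C_def by blast
      obtain d where d: "d \<in> D" "le d1 d" "le d2 d" using up[OF d1(1) d2(1)] by blast
      have "\<forall>e\<in>D. le d e \<longrightarrow> f (s e) \<notin> \<Union>(insert V C')"
      proof (intro ballI impI)
        fix e assume e: "e \<in> D" "le d e"
        have "le d1 e" "le d2 e"
          using trans[OF d1(1) d(1) e(1) d(2) e(2)] trans[OF d2(1) d(1) e(1) d(3) e(2)] .
        then show "f (s e) \<notin> \<Union>(insert V C')" using d1(2) d2(2) e(1) by blast
      qed
      then show ?case using d(1) by blast
    qed
    then obtain d1 where d1: "d1 \<in> D" "\<And>e. e \<in> D \<Longrightarrow> le d1 e \<Longrightarrow> f (s e) \<notin> \<Union>C'"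
      by metis
    have "open (\<Union>C')" using C'(1) by (auto simp: C_def)
    then obtain U where U: "open U" "x \<in> U" "\<And>u. u \<in> U \<Longrightarrow> F `` {u} \<subseteq> \<Union>C'"
      using usco_nhdE[OF F _ C'(3)] by blast
    obtain d2 where d2: "d2 \<in> D" "\<And>e. e \<in> D \<Longrightarrow> le d2 e \<Longrightarrow> s e \<in> U"
      using lim U(1,2) unfolding net_tendsto_def by metis
    obtain d where d: "d \<in> D" "le d1 d" "le d2 d" using up[OF d1(1) d2(1)] by blast
    have "f (s d) \<in> F `` {s d}" using f by (simp add: selection_def)
    then show False using d1(2)[OF d(1,2)] d2(2)[OF d(1,3)] U(3) by blast
  qed
  then obtain y where "\<And>V d. \<lbrakk>open V; y \<in> V; d \<in> D\<rbrakk> \<Longrightarrow> \<exists>e\<in>D. le d e \<and> (f \<circ> s) e \<in> V"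
    by (metis comp_apply)
  then show "\<exists>(E :: (('a \<times> 'a set) \<times> 'b set) set) le' \<phi> y.
      subnet_map D le E le' \<phi> \<and> net_tendsto E le' (f \<circ> s \<circ> \<phi>) y"
    using cluster_point_imp_convergent_subnet[OF dir, of y "f \<circ> s"] by blast
qed

section \<open>Minimal usco maps\<close>

text \<open>Deleting the box leaves each value over \<open>U\<close> nonempty by \<open>ne\<close>,
  and compact because only an open set is removed.\<close>

lemma usco_Diff_Times:
  assumes F: "usco F" and U: "open U" and V: "open V"
    and ne: "\<And>u. u \<in> U \<Longrightarrow> \<not> F `` {u} \<subseteq> V"
  shows "usco (F - U \<times> V)"
  unfolding usco_def upper_semicontinuous_def
proof (intro conjI allI impI)
  fix x
  have val: "(F - U \<times> V) `` {x} = (if x \<in> U then F `` {x} - V else F `` {x})"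
    by auto
  show "(F - U \<times> V) `` {x} \<noteq> {}" "compact ((F - U \<times> V) `` {x})"
    unfolding val using F ne V by (auto simp: usco_def intro: compact_diff)
  fix O' assume O: "open O' \<and> (F - U \<times> V) `` {x} \<subseteq> O'"
  show "\<exists>N. open N \<and> x \<in> N \<and> (\<forall>u\<in>N. (F - U \<times> V) `` {u} \<subseteq> O')"
  proof (cases "x \<in> U")
    case True
    \<comment> \<open>The points deleted over \<open>U\<close> are exactly those in
      \<open>V\<close>, so the target is enlarged by \<open>V\<close> for \<open>F\<close> and cut
      back on \<open>N \<inter> U\<close>.\<close>
    then have "open (O' \<union> V)" "F `` {x} \<subseteq> O' \<union> V" using O V by auto
    then obtain N where N: "open N" "x \<in> N" "\<And>u. u \<in> N \<Longrightarrow> F `` {u} \<subseteq> O' \<union> V"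
      using usco_nhdE[OF F] by blast
    have "\<forall>u\<in>N \<inter> U. (F - U \<times> V) `` {u} \<subseteq> O'" using N(3) by blast
    then show ?thesis using N(1,2) U True by (intro exI[of _ "N \<inter> U"]) auto
  next
    case False
    then have "open O'" "F `` {x} \<subseteq> O'" using O by auto
    then obtain N where N: "open N" "x \<in> N" "\<And>u. u \<in> N \<Longrightarrow> F `` {u} \<subseteq> O'"
      using usco_nhdE[OF F] by blast
    have "\<forall>u\<in>N. (F - U \<times> V) `` {u} \<subseteq> O'" using N(3) by blast
    then show ?thesis using N(1,2) by blast
  qed
qed

lemma minimal_usco_open_subset:
  assumes F: "F \<in> MU" and xy: "(x, y) \<in> F"
    and U: "open U" "x \<in> U" and V: "open V" "y \<in> V"
  obtains W where "open W" "W \<noteq> {}" "W \<subseteq> U" "\<And>w. w \<in> W \<Longrightarrow> F `` {w} \<subseteq> V"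
proof -
  have usco: "usco F" and min: "\<And>G. usco G \<Longrightarrow> \<not> G \<subset> F"
    using F by (auto simp: MU_def)
  have "F - U \<times> V \<subset> F" using xy U V by blast
  then obtain u where u: "u \<in> U" "F `` {u} \<subseteq> V"
    using min usco_Diff_Times[OF usco U(1) V(1)] by blast
  \<comment> \<open>A single value inside \<open>V\<close> spreads to an open set by upper
    semicontinuity.\<close>
  obtain N where "open N" "u \<in> N" "\<And>w. w \<in> N \<Longrightarrow> F `` {w} \<subseteq> V"
    using usco_nhdE[OF usco V(1) u(2)] by blast
  then show thesis using that[of "N \<inter> U"] u U by blast
qed

text \<open>Minimality among usco maps turns the inclusion of \<open>graph_closure f\<close> in
  \<open>F\<close> into equality. Compact convex values are their own closed convex hulls, so each
  \<open>y\<close> in the definition of *-quasicontinuity is already a value of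
  \<open>F\<close>.\<close>

lemma minimal_usco_cusco_selection:
  fixes F :: "('a::topological_space \<times> 'b::{topological_real_vector,t2_space}) set"
  assumes F: "F \<in> MU" "cusco F" and f: "selection F f"
  shows "star_quasicontinuous f" "subcontinuous f" "graph_closure f = F"
proof -
  have usco: "usco F" using F(1) by (simp add: MU_def)
  show sub: "subcontinuous f" using usco f by (rule usco_selection_subcontinuous)
  have "graph_closure f \<subseteq> F" using usco_closed[OF usco] f by (rule graph_closure_subset)
  then show eq: "graph_closure f = F"
    using F(1) usco_graph_closure[OF sub] by (auto simp: MU_def)
  show "star_quasicontinuous f"
    unfolding star_quasicontinuous_def
  proof (intro allI ballI impI)
    fix x y U V
    assume y: "y \<in> closure (convex hull (graph_closure f `` {x}))"
      and UV: "open V \<and> y \<in> V \<and> open U \<and> x \<in> U"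
    have "convex (F `` {x})" "compact (F `` {x})"
      using F(2) by (auto simp: cusco_def usco_def)
    then have "(x, y) \<in> F"
      using y by (simp add: eq convex_hull_eq[THEN iffD2] compact_imp_closed)
    then obtain W where W: "open W" "W \<noteq> {}" "W \<subseteq> U" "\<And>w. w \<in> W \<Longrightarrow> F `` {w} \<subseteq> V"
      using minimal_usco_open_subset[OF F(1), of x y U V] UV by blast
    have "f ` W \<subseteq> V" using W(4) f unfolding selection_def by blast
    then show "\<exists>W. open W \<and> W \<noteq> {} \<and> W \<subseteq> U \<and> f ` W \<subseteq> V"
      using W(1-3) by blast
  qed
qed

section \<open>Star-quasicontinuous functions\<close>

lemma star_quasicontinuousE:
  assumes "star_quasicontinuous f" "y \<in> closure (convex hull (graph_closure f `` {x}))"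
    and "open U" "x \<in> U" "open V" "y \<in> V"
  obtains W where "open W" "W \<noteq> {}" "W \<subseteq> U" "f ` W \<subseteq> V"
proof -
  have "\<exists>W. open W \<and> W \<noteq> {} \<and> W \<subseteq> U \<and> f ` W \<subseteq> V"
    using assms(1)[unfolded star_quasicontinuous_def, rule_format, OF assms(2), of V U]
      assms(3-) by simp
  then show thesis using that by metis
qed

text \<open>Any point of the nonempty set \<open>W\<close> shows that the box
  \<open>U \<times> V\<close> meets the graph of \<open>f\<close>. Each value is thus its own closed
  convex hull, in particular convex.\<close>

lemma star_quasicontinuous_convex_hull:
  assumes "star_quasicontinuous f"
  shows "closure (convex hull (graph_closure f `` {x})) \<subseteq> graph_closure f `` {x}"
proof
  fix y assume y: "y \<in> closure (convex hull (graph_closure f `` {x}))"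
  have "\<exists>u\<in>U. f u \<in> V" if UV: "open U" "x \<in> U" "open V" "y \<in> V" for U V
  proof -
    obtain W where "W \<noteq> {}" "W \<subseteq> U" "f ` W \<subseteq> V"
      using star_quasicontinuousE[OF assms y UV] .
    then show ?thesis by blast
  qed
  then show "y \<in> graph_closure f `` {x}" by (auto simp: mem_graph_closure_iff)
qed

lemma star_quasicontinuous_imp_minimal:
  fixes f :: "'a::topological_space \<Rightarrow> 'b::{topological_real_vector,t2_space}"
  assumes f: "star_quasicontinuous f" "subcontinuous f"
  shows "graph_closure f \<in> MU \<inter> MC"
proof -
  have usco: "usco (graph_closure f)" using f(2) by (rule usco_graph_closure)
  have "convex (graph_closure f `` {x})" for x
  proof -
    have "convex hull (graph_closure f `` {x}) = graph_closure f `` {x}"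
      using star_quasicontinuous_convex_hull[OF f(1), of x]
        closure_subset hull_subset by (metis subset_antisym subset_trans)
    then show ?thesis by (metis convex_convex_hull)
  qed
  then have cusco: "cusco (graph_closure f)" using usco by (simp add: cusco_def)
  \<comment> \<open>Since cusco maps are usco, excluding smaller usco maps gives both kinds of
    minimality at once.\<close>
  have min: "graph_closure f \<subseteq> G" if G: "usco G" "G \<subseteq> graph_closure f" for G
  proof
    fix p assume p: "p \<in> graph_closure f"
    obtain x y where xy: "p = (x, y)" by fastforce
    show "p \<in> G"
    proof (rule ccontr)
      assume "p \<notin> G"
      then have y: "y \<notin> G `` {x}" by (simp add: xy)
      have "compact (G `` {x})" using G(1) by (simp add: usco_def)
      then obtain V V' where V: "open V" "open V'" "y \<in> V" "G `` {x} \<subseteq> V'"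
          "closure V \<inter> V' = {}"
        using y by (rule separate_point_compact)
      obtain U where U: "open U" "x \<in> U" "\<And>u. u \<in> U \<Longrightarrow> G `` {u} \<subseteq> V'"
        using usco_nhdE[OF G(1) V(2,4)] by blast
      have "y \<in> closure (convex hull (graph_closure f `` {x}))"
        using p xy closure_subset hull_subset by (metis Image_singleton_iff subsetD)
      then obtain W where W: "open W" "W \<noteq> {}" "W \<subseteq> U" "f ` W \<subseteq> V"
        using star_quasicontinuousE[OF f(1) _ U(1,2) V(1,3)] by metis
      then obtain w where w: "w \<in> W" by blast
      have "graph_closure f `` {w} \<subseteq> closure V"
        using graph_closure_image_subset[OF W(1) w, of f] closure_mono[OF W(4)] by blast
      \<comment> \<open>Over \<open>w\<close> the values of \<open>G\<close> lie in
        \<open>closure V\<close>, as part of \<open>graph_closure f\<close>, and in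
        \<open>V'\<close>, as \<open>w \<in> U\<close>; these sets are disjoint.\<close>
      then have "G `` {w} = {}" using G(2) U(3)[of w] W(3) w V(5) by blast
      then show False using G(1) by (simp add: usco_def)
    qed
  qed
  show ?thesis
    using usco cusco min by (auto simp: MU_def MC_def cusco_def)
qed

theorem theorem2p4:
  fixes F :: "('a::t2_space \<times> 'b::{locally_convex_space,t2_space}) set"
  shows "(F \<in> MU \<inter> MC \<longleftrightarrow>
            (\<exists>f. star_quasicontinuous f \<and> subcontinuous f \<and> graph_closure f = F)) \<and>
         (F \<in> MU \<inter> MC \<longleftrightarrow>
            (\<exists>f. selection F f) \<and>
            (\<forall>f. selection F f \<longrightarrow>
                 star_quasicontinuous f \<and> subcontinuous f \<and> graph_closure f = F))"
proof -
  \<comment> \<open>Besides the existence clause in (3), this supplies the function for (2);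
    conversely, a selection as in (3) is a witness for (2).\<close>
  have ex: "\<exists>f. selection F f" if "F \<in> MU \<inter> MC"
  proof -
    have "\<forall>x. \<exists>y. y \<in> F `` {x}" using that by (auto simp: MU_def usco_def)
    then show ?thesis unfolding selection_def by (rule choice)
  qed
  have all: "star_quasicontinuous f \<and> subcontinuous f \<and> graph_closure f = F"
    if "F \<in> MU \<inter> MC" "selection F f" for f
    using minimal_usco_cusco_selection[of F f] that by (auto simp: MC_def)
  have minimal: "F \<in> MU \<inter> MC"
    if "star_quasicontinuous f" "subcontinuous f" "graph_closure f = F" for f
    using star_quasicontinuous_imp_minimal that by blast
  show ?thesis using ex all minimal by blast
qed

end
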